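(* Let $G$ be a topological gyrogroup whose underlying space is a Baire space. Then the following are equivalent: (i) $G$ is metrizable. (ii) $G$ has the strong Pytkeev property. (iii) $G$ has countable $ck$-character. (iv) $G$ has countable $cn$-character. (v) $G$ has an $\omega^{\omega}$-base satisfying the condition $(\mathbf{D})$.
   Context: $\mathbb{N}$ is the set of positive integers. All topological spaces are assumed Hausdorff. A gyrogroup is a set $G$ with a binary operation $\oplus$ such that: (G1) there is a unique $0\in G$ with $0\oplus a=a=a\oplus 0$ for all $a$; (G2) for each $x$ there is a unique $\ominus x\in G$ with $\ominus x\oplus x=0=x\oplus(\ominus x)$; (G3) for all $x,y\in G$ there is an automorphism $\mathrm{gyr}[x,y]$ of $(G,\oplus)$ with $x\oplus(y\oplus z)=(x\oplus y)\oplus\mathrm{gyr}[x,y](z)$ for all $z\in G$; (G4) $\mathrm{gyr}[x\oplus y,y]=\mathrm{gyr}[x,y]$ for all $x,y\in G$. A topological gyrogroup is a gyrogroup with a topology for which $\oplus:G\times G\to G$ is jointly continuous and $x\mapsto\ominus x$ is continuous. $G$ has the strong Pytkeev property if there is a sequence $\{D_n\}_{n\in\mathbb{N}}$ of subsets of $G$ such that for each neighborhood $U$ of $0$ and each $A\subset G$ with $0\in\overline{A}\setminus A$ there is $n\in\mathbb{N}$ such that $D_n\subset U$ and $D_n\cap A$ is infinite. A family $\mathcal{N}$ of subsets of a space $X$ is a $cn$-network at $x\in X$ if for each neighborhood $O_x$ of $x$ the set $\bigcup\{N\in\mathcal{N}:x\in N\subset O_x\}$ is a neighborhood of $x$. It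 is a $ck$-network at $x$ if for each neighborhood $O_x$ of $x$ there is a neighborhood $U_x$ of $x$ such that for each compact subset $K\subset U_x$ there is a finite subfamily $\mathcal{F}\subset\mathcal{N}$ with $x\in\bigcap\mathcal{F}$ and $K\subset\bigcup\mathcal{F}\subset O_x$. $X$ has countable $cn$-character (respectively countable $ck$-character) if at each point $x\in X$ there is a countable $cn$-network (respectively countable $ck$-network). $\mathbb{N}^{\mathbb{N}}$ carries the pointwise partial order: $\alpha\le\beta$ iff $\alpha_i\le\beta_i$ for all $i$. An $\omega^{\omega}$-base of a topological gyrogroup $G$ is a family $\{U_\alpha:\alpha\in\mathbb{N}^{\mathbb{N}}\}$ of neighborhoods of $0$ that is a base of neighborhoods at $0$ and satisfies $U_\beta\subset U_\alpha$ whenever $\alpha\le\beta$. It satisfies the condition $(\mathbf{D})$ if $U_\alpha=\bigcup_{k\in\mathbb{N}}\bigcap_{\beta\in I_k(\alpha)}U_\beta$ for every $\alpha\in\mathbb{N}^{\mathbb{N}}$, where $I_k(\alpha)=\{\beta\in\mathbb{N}^{\mathbb{N}}:\beta_i=\alpha_i\text{ for }i=1,\dots,k\}$. *)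

theory Defs
  imports "HOL-Analysis.Analysis"
begin

section \<open>Topological gyrogroups\<close>

text \<open>
  The carrier of a gyrogroup is an arbitrary type. The neutral element, the inversion and the
  gyrations are determined by the operation (for the gyrations, by left cancellation), so taking
  them as parameters adds no structure.
\<close>

locale gyrogroup =
  fixes gadd :: "'a \<Rightarrow> 'a \<Rightarrow> 'a" (infixl "\<oplus>" 65)
    and gzero :: "'a" ("\<zero>")
    and gminus :: "'a \<Rightarrow> 'a" ("\<ominus> _" [81] 80)
    and gyr :: "'a \<Rightarrow> 'a \<Rightarrow> 'a \<Rightarrow> 'a"
  assumes zero_left: "\<zero> \<oplus> a = a"
    and zero_right: "a \<oplus> \<zero> = a"
    and zero_unique: "(\<And>a. e \<oplus> a = a \<and> a \<oplus> e = a) \<Longrightarrow> e = \<zero>"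
    and minus_left: "(\<ominus> x) \<oplus> x = \<zero>"
    and minus_right: "x \<oplus> (\<ominus> x) = \<zero>"
    and minus_unique: "y \<oplus> x = \<zero> \<Longrightarrow> x \<oplus> y = \<zero> \<Longrightarrow> y = \<ominus> x"
    and gyr_bij: "bij (gyr x y)"
    and gyr_hom: "gyr x y (a \<oplus> b) = gyr x y a \<oplus> gyr x y b"
    and gyr_assoc: "x \<oplus> (y \<oplus> z) = (x \<oplus> y) \<oplus> gyr x y z"
    and gyr_loop: "gyr (x \<oplus> y) y = gyr x y"

locale topological_gyrogroup = gyrogroup gadd gzero gminus gyr
  for gadd :: "'a::t2_space \<Rightarrow> 'a \<Rightarrow> 'a" (infixl "\<oplus>" 65)
    and gzero :: "'a" ("\<zero>")
    and gminus :: "'a \<Rightarrow> 'a" ("\<ominus> _" [81] 80)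
    and gyr :: "'a \<Rightarrow> 'a \<Rightarrow> 'a \<Rightarrow> 'a" +
  assumes continuous_add: "continuous_on UNIV (\<lambda>(x, y). x \<oplus> y)"
    and continuous_minus: "continuous_on UNIV (\<lambda>x. \<ominus> x)"


section \<open>Topological properties\<close>

text \<open>Neighborhoods need not be open.\<close>

definition is_nbhd :: "'a::topological_space \<Rightarrow> 'a set \<Rightarrow> bool" where
  "is_nbhd x U \<longleftrightarrow> (\<exists>V. open V \<and> x \<in> V \<and> V \<subseteq> U)"

definition baire_space :: "'a::topological_space itself \<Rightarrow> bool" where
  "baire_space _ \<longleftrightarrow>
    (\<forall>\<G>::'a set set. countable \<G> \<and> (\<forall>G\<in>\<G>. open G \<and> closure G = UNIV)
       \<longrightarrow> closure (\<Inter>\<G>) = UNIV)"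

definition strong_Pytkeev_at :: "'a::topological_space \<Rightarrow> bool" where
  "strong_Pytkeev_at x \<longleftrightarrow>
    (\<exists>D :: nat \<Rightarrow> 'a set. \<forall>U A. is_nbhd x U \<and> x \<in> closure A - A
       \<longrightarrow> (\<exists>n. D n \<subseteq> U \<and> infinite (D n \<inter> A)))"

definition cn_network_at :: "'a::topological_space \<Rightarrow> 'a set set \<Rightarrow> bool" where
  "cn_network_at x \<N> \<longleftrightarrow>
    (\<forall>W. is_nbhd x W \<longrightarrow> is_nbhd x (\<Union>{N \<in> \<N>. x \<in> N \<and> N \<subseteq> W}))"

definition ck_network_at :: "'a::topological_space \<Rightarrow> 'a set set \<Rightarrow> bool" where
  "ck_network_at x \<N> \<longleftrightarrow>
    (\<forall>W. is_nbhd x W \<longrightarrow>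
      (\<exists>U. is_nbhd x U \<and>
        (\<forall>K. compact K \<and> K \<subseteq> U \<longrightarrow>
          (\<exists>\<F>. finite \<F> \<and> \<F> \<subseteq> \<N> \<and> x \<in> \<Inter>\<F> \<and> K \<subseteq> \<Union>\<F> \<and> \<Union>\<F> \<subseteq> W))))"

definition countable_cn_character :: "'a::topological_space itself \<Rightarrow> bool" where
  "countable_cn_character _ \<longleftrightarrow> (\<forall>x::'a. \<exists>\<N>. countable \<N> \<and> cn_network_at x \<N>)"

definition countable_ck_character :: "'a::topological_space itself \<Rightarrow> bool" where
  "countable_ck_character _ \<longleftrightarrow> (\<forall>x::'a. \<exists>\<N>. countable \<N> \<and> ck_network_at x \<N>)"


section \<open>Bases indexed by sequences of natural numbers\<close>

text \<open>
  Sequences of positive integers indexed by the positive integers are represented by functions of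
  type \<^typ>\<open>nat \<Rightarrow> nat\<close>, which is order-isomorphic to them by shifting arguments and
  values by one; \<open>\<le>\<close> on this type is the pointwise order. After the shift, the first \<open>k\<close>
  coordinates are those with index \<open>i < k\<close>.
\<close>

definition omega_omega_base_at ::
    "'a::topological_space \<Rightarrow> ((nat \<Rightarrow> nat) \<Rightarrow> 'a set) \<Rightarrow> bool" where
  "omega_omega_base_at x U \<longleftrightarrow>
    (\<forall>\<alpha>. is_nbhd x (U \<alpha>)) \<and>
    (\<forall>W. is_nbhd x W \<longrightarrow> (\<exists>\<alpha>. U \<alpha> \<subseteq> W)) \<and>
    (\<forall>\<alpha> \<beta>. \<alpha> \<le> \<beta> \<longrightarrow> U \<beta> \<subseteq> U \<alpha>)"

definition same_prefix :: "nat \<Rightarrow> (nat \<Rightarrow> nat) \<Rightarrow> (nat \<Rightarrow> nat) set" where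
  "same_prefix k \<alpha> = {\<beta>. \<forall>i<k. \<beta> i = \<alpha> i}"

definition condition_D :: "((nat \<Rightarrow> nat) \<Rightarrow> 'a set) \<Rightarrow> bool" where
  "condition_D U \<longleftrightarrow> (\<forall>\<alpha>. U \<alpha> = (\<Union>k\<in>{1..}. \<Inter>\<beta>\<in>same_prefix k \<alpha>. U \<beta>))"

end

theory Submission
  imports Defs
begin

text \<open>
  All five properties meet in a single one: a countable neighborhood base at the neutral element.

  Metrizability yields countable bases at all points, and a decreasing base \<open>B\<close> at a point is at once
  a witness of the strong Pytkeev property and a countable \<open>ck\<close>-network there, while
  \<open>\<alpha> \<mapsto> B (\<alpha> 0)\<close> is an \<open>\<omega>\<^sup>\<omega>\<close>-base with the condition (D). Conversely, each of the
  other properties yields a countable \<open>cn\<close>-network at the neutral element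
  (\<open>strong_Pytkeev_imp_cn_network\<close>, \<open>ck_network_imp_cn_network\<close>, \<open>condition_D_imp_cn_network\<close>).

  The Baire property turns such a network into a neighborhood base. If a \<open>cn\<close>-network \<open>\<N>\<close> at \<open>\<zero>\<close> is countable,
  then for every open \<open>V\<close> around \<open>\<zero>\<close> the members of \<open>\<N>\<close> inside \<open>V\<close> cover a nonempty open set, so the
  closure of one of them, \<open>N\<close>, has an interior point \<open>x\<close>. Translating by \<open>\<ominus> x\<close> shows that
  \<open>{\<ominus> a \<oplus> b | a b. a \<in> closure N \<and> b \<in> closure N}\<close> is a neighborhood of \<open>\<zero>\<close>, and it is small if \<open>V\<close>
  is small. These sets form a countable base at \<open>\<zero>\<close> (\<open>metrizable_if_Baire_cn_network\<close>).

  It remains to see that a topological gyrogroup with a decreasing base \<open>B\<close> at \<open>\<zero>\<close> is metrizable.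
  The pairs with \<open>\<ominus> x \<oplus> y \<in> B n\<close> need not form a base of a uniformity, because the
  gyrations need not be equicontinuous at \<open>\<zero>\<close>. But the sets \<open>x \<oplus> B n\<close> satisfy the pointwise condition of Frink's
  metrization theorem: if \<open>x \<oplus> B m\<close> meets \<open>y \<oplus> B m\<close>, say \<open>x \<oplus> a = y \<oplus> b\<close>, then
  \<open>y \<oplus> c\<close> depends continuously on \<open>(a, b, c)\<close> and equals \<open>x\<close> at \<open>(\<zero>, \<zero>, \<zero>)\<close>, because right
  translations can be inverted by a continuous formula (\<open>right_diff\<close>).
  Frink's theorem is proved by passing to a subsequence of each local base, chosen so that pairs lying in a
  common basic set do form a countable base of a uniformity, and by the usual chain metric.
\<close>

section \<open>Neighborhoods\<close>

lemma is_nbhd_mono: "is_nbhd x U \<Longrightarrow> U \<subseteq> W \<Longrightarrow> is_nbhd x W"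
  unfolding is_nbhd_def by blast

lemma is_nbhd_Int: "is_nbhd x U \<Longrightarrow> is_nbhd x W \<Longrightarrow> is_nbhd x (U \<inter> W)"
  unfolding is_nbhd_def by (metis Int_iff Int_mono open_Int)

lemma mem_is_nbhd: "is_nbhd x U \<Longrightarrow> x \<in> U"
  unfolding is_nbhd_def by blast

lemma open_is_nbhd: "open U \<Longrightarrow> x \<in> U \<Longrightarrow> is_nbhd x U"
  unfolding is_nbhd_def by blast

lemma is_nbhd_INT_atMost: "(\<And>i. is_nbhd x (B i)) \<Longrightarrow> is_nbhd x (\<Inter>i\<le>n::nat. B i)"
  by (induction n) (auto simp: atMost_Suc intro: is_nbhd_Int)

definition decreasing_nbhd_base_at :: "'a::topological_space \<Rightarrow> (nat \<Rightarrow> 'a set) \<Rightarrow> bool" where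
  "decreasing_nbhd_base_at x B \<longleftrightarrow>
    (\<forall>n. is_nbhd x (B n)) \<and> antimono B \<and> (\<forall>W. is_nbhd x W \<longrightarrow> (\<exists>n. B n \<subseteq> W))"

lemma countable_nbhd_base_imp_decreasing:
  assumes "countable \<B>" and nb: "\<And>B. B \<in> \<B> \<Longrightarrow> is_nbhd x B"
    and base: "\<And>W. is_nbhd x W \<Longrightarrow> \<exists>B\<in>\<B>. B \<subseteq> W"
  obtains B where "decreasing_nbhd_base_at x B"
proof -
  have ne: "\<B> \<noteq> {}"
    using base[OF open_is_nbhd[OF open_UNIV]] by auto
  define B where "B n = (\<Inter>i\<le>n. from_nat_into \<B> i)" for n
  have "is_nbhd x (B n)" for n
    unfolding B_def by (intro is_nbhd_INT_atMost nb from_nat_into ne)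
  moreover have "antimono B"
    unfolding B_def antimono_def by force
  moreover have "\<exists>n. B n \<subseteq> W" if W: "is_nbhd x W" for W
  proof -
    obtain C where "C \<in> \<B>" "C \<subseteq> W" using base[OF W] by blast
    moreover obtain n where "from_nat_into \<B> n = C"
      using from_nat_into_surj[OF \<open>countable \<B>\<close> \<open>C \<in> \<B>\<close>] by blast
    ultimately show ?thesis unfolding B_def by blast
  qed
  ultimately show ?thesis using that unfolding decreasing_nbhd_base_at_def by blast
qed

lemma metrizable_imp_decreasing_nbhd_base:
  fixes x :: "'a::topological_space"
  assumes "metrizable_space (euclidean :: 'a topology)"
  obtains B where "decreasing_nbhd_base_at x B"
proof -
  obtain M d where "Metric_space M d" and top: "(euclidean :: 'a topology) = Metric_space.mtopology M d"
    using assms unfolding metrizable_space_def by blast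
  then interpret Metric_space M d by simp
  have M: "M = UNIV" using topspace_mtopology top by (metis topspace_euclidean)
  have open_iff: "open U \<longleftrightarrow> (\<forall>y\<in>U. \<exists>r>0. mball y r \<subseteq> U)" for U
    using openin_mtopology[of U] M unfolding top[symmetric] by auto
  define B where "B n = mball x (inverse (Suc n))" for n
  have "is_nbhd x (B n)" for n
    unfolding B_def
  proof (rule open_is_nbhd)
    show "open (mball x (inverse (Suc n)))"
      using openin_mball[of x] unfolding top[symmetric] by simp
    show "x \<in> mball x (inverse (Suc n))" using M by (subst centre_in_mball_iff) auto
  qed
  moreover have "antimono B"
    unfolding B_def antimono_def
    by (auto intro!: mball_subset_concentric le_imp_inverse_le)
  moreover have "\<exists>n. B n \<subseteq> W" if W: "is_nbhd x W" for W
  proof -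
    obtain r where r: "r > 0" "mball x r \<subseteq> W"
      using W open_iff unfolding is_nbhd_def by (meson subset_trans)
    obtain n where "inverse (real (Suc n)) < r"
      using reals_Archimedean[OF r(1)] by blast
    then have "B n \<subseteq> mball x r" unfolding B_def by (auto intro!: mball_subset_concentric)
    with r show ?thesis by blast
  qed
  ultimately show ?thesis using that unfolding decreasing_nbhd_base_at_def by blast
qed

section \<open>The metric of a countable family of entourages\<close>

text \<open>
  The constant 2 does not grow with the length of the chain: a chain of weight \<open>s\<close> is cut into two
  subchains of weight at most \<open>s / 2\<close> and one link of weight at most \<open>s\<close>. By induction the end points of
  each piece are at \<open>f\<close>-distance at most \<open>s\<close>, and the relaxed triangle inequality for three pieces
  gives \<open>2 * s\<close>.
\<close>

lemma chain_inequality: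
  fixes f :: "'a \<Rightarrow> 'a \<Rightarrow> real" and p :: "nat \<Rightarrow> 'a"
  assumes nonneg: "\<And>x y. 0 \<le> f x y" and refl: "\<And>x. f x x = 0"
    and relaxed: "\<And>a b c d e. f a b \<le> e \<Longrightarrow> f b c \<le> e \<Longrightarrow> f c d \<le> e \<Longrightarrow> f a d \<le> 2 * e"
  shows "f (p 0) (p n) \<le> 2 * (\<Sum>i<n. f (p i) (p (Suc i)))"
proof (induction n arbitrary: p rule: less_induct)
  case (less n)
  show ?case
  proof (cases "n = 0")
    case True
    then show ?thesis by (simp add: refl)
  next
    case False
    define T where "T j = (\<Sum>i<j. f (p i) (p (Suc i)))" for j
    have T0: "0 \<le> T j" for j unfolding T_def by (simp add: sum_nonneg nonneg)
    \<comment> \<open>The chain is cut at its middle link, from \<open>p j\<close> to \<open>p (Suc j)\<close>: the parts on either side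
      weigh at most half of the total. Requiring \<open>j < n\<close> keeps a link there even if the total is zero.\<close>
    define j where "j = Max {j. j < n \<and> T j \<le> T n / 2}"
    have fin: "finite {j. j < n \<and> T j \<le> T n / 2}" by simp
    have "0 \<in> {j. j < n \<and> T j \<le> T n / 2}" using False T0[of n] by (simp add: T_def)
    then have jmem: "j \<in> {j. j < n \<and> T j \<le> T n / 2}"
      unfolding j_def using fin by (intro Max_in) auto
    then have jn: "j < n" and Tj: "T j \<le> T n / 2" by auto
    have split: "T n = T (Suc j) + (\<Sum>i<n - Suc j. f (p (i + Suc j)) (p (Suc (i + Suc j))))"
    proof -
      have "T n = T (Suc j) + (\<Sum>i=Suc j..<n. f (p i) (p (Suc i)))"
        unfolding T_def lessThan_atLeast0 using jn by (intro sum.atLeastLessThan_concat[symmetric]) auto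
      also have "(\<Sum>i=Suc j..<n. f (p i) (p (Suc i))) =
          (\<Sum>i<n - Suc j. f (p (i + Suc j)) (p (Suc (i + Suc j))))"
        using sum.shift_bounds_nat_ivl[of "\<lambda>i. f (p i) (p (Suc i))" 0 "Suc j" "n - Suc j"] jn
        by (simp add: lessThan_atLeast0)
      finally show ?thesis .
    qed
    have rest: "(\<Sum>i<n - Suc j. f (p (i + Suc j)) (p (Suc (i + Suc j)))) \<le> T n / 2"
    proof (cases "Suc j = n")
      case True
      then show ?thesis using T0[of n] by simp
    next
      case False
      have "\<not> T (Suc j) \<le> T n / 2"
      proof
        assume "T (Suc j) \<le> T n / 2"
        then have "Suc j \<in> {j. j < n \<and> T j \<le> T n / 2}" using False jn by auto
        then have "Suc j \<le> j" unfolding j_def using fin by (intro Max_ge) auto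
        then show False by simp
      qed
      then show ?thesis using split by linarith
    qed
    have "f (p 0) (p j) \<le> T n"
      using less.IH[OF jn, of p] Tj unfolding T_def by linarith
    moreover have "f (p j) (p (Suc j)) \<le> T n"
      using split T0[of j] sum_nonneg[of "{..<n - Suc j}" "\<lambda>i. f (p (i + Suc j)) (p (Suc (i + Suc j)))"] nonneg
      by (simp add: T_def)
    moreover have "f (p (Suc j)) (p n) \<le> T n"
      using less.IH[of "n - Suc j" "\<lambda>i. p (i + Suc j)"] rest jn by simp
    ultimately show ?thesis using relaxed unfolding T_def by blast
  qed
qed

text \<open>
  The metric is the infimum of the weights of all chains between two points; chains can be
  concatenated and reversed, and \<open>chain_inequality\<close> keeps the infimum from collapsing.
\<close>

lemma metric_between_relaxed_metric:
  fixes f :: "'a \<Rightarrow> 'a \<Rightarrow> real"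
  assumes nonneg: "\<And>x y. 0 \<le> f x y" and zero: "\<And>x y. f x y = 0 \<longleftrightarrow> x = y"
    and sym: "\<And>x y. f x y = f y x"
    and relaxed: "\<And>a b c d e. f a b \<le> e \<Longrightarrow> f b c \<le> e \<Longrightarrow> f c d \<le> e \<Longrightarrow> f a d \<le> 2 * e"
  obtains d where "Metric_space UNIV d" and "\<And>x y. d x y \<le> f x y" and "\<And>x y. f x y \<le> 2 * d x y"
proof -
  \<comment> \<open>The weights of all chains from \<open>x\<close> to \<open>y\<close>.\<close>
  define S where "S x y = {\<Sum>i<n. f (p i) (p (Suc i)) | n p. p (0::nat) = x \<and> p n = y}" for x y
  define d where "d x y = Inf (S x y)" for x y
  have f_S: "f x y \<in> S x y" for x y
    unfolding S_def by (rule CollectI, rule exI[of _ 1], rule exI[of _ "\<lambda>i. if i = 0 then x else y"]) simp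
  have lower: "f x y \<le> 2 * s" if "s \<in> S x y" for s x y
  proof -
    have "f (p 0) (p n) \<le> 2 * (\<Sum>i<n. f (p i) (p (Suc i)))" for p n
      by (rule chain_inequality) (use nonneg zero relaxed in blast)+
    then show ?thesis using that unfolding S_def by blast
  qed
  have bdd: "bdd_below (S x y)" for x y
    by (rule bdd_belowI[of _ "f x y / 2"]) (use lower in force)
  have S_sym: "s \<in> S y x" if s: "s \<in> S x y" for s x y
  proof -
    obtain n p where p: "p 0 = x" "p n = y" "s = (\<Sum>i<n. f (p i) (p (Suc i)))"
      using s unfolding S_def by blast
    have "s = (\<Sum>i<n. f (p (n - Suc i)) (p (Suc (n - Suc i))))"
      unfolding p(3) by (rule sum.nat_diff_reindex[symmetric])
    also have "\<dots> = (\<Sum>i<n. f (p (n - i)) (p (n - Suc i)))"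
      by (intro sum.cong refl) (simp add: Suc_diff_Suc sym)
    finally show ?thesis unfolding S_def using p
      by (intro CollectI exI[of _ n] exI[of _ "\<lambda>i. p (n - i)"]) simp
  qed
  have S_trans: "s + t \<in> S x z" if s: "s \<in> S x y" and t: "t \<in> S y z" for s t x y z
  proof -
    obtain n p where p: "p 0 = x" "p n = y" "s = (\<Sum>i<n. f (p i) (p (Suc i)))"
      using s unfolding S_def by blast
    obtain m q where q: "q 0 = y" "q m = z" "t = (\<Sum>i<m. f (q i) (q (Suc i)))"
      using t unfolding S_def by blast
    define r where "r i = (if i \<le> n then p i else q (i - n))" for i
    have rq: "r (i + n) = q i" for i using p q by (simp add: r_def)
    have "(\<Sum>i<n+m. f (r i) (r (Suc i))) =
        (\<Sum>i=0..<n. f (r i) (r (Suc i))) + (\<Sum>i=0+n..<m+n. f (r i) (r (Suc i)))"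
      by (simp add: lessThan_atLeast0 add.commute sum.atLeastLessThan_concat)
    also have "(\<Sum>i=0+n..<m+n. f (r i) (r (Suc i))) = t"
      unfolding sum.shift_bounds_nat_ivl q(3) lessThan_atLeast0
      using rq by (metis add_Suc)
    also have "(\<Sum>i=0..<n. f (r i) (r (Suc i))) = s"
      unfolding p(3) lessThan_atLeast0 by (intro sum.cong) (auto simp: r_def)
    finally have "s + t = (\<Sum>i<n+m. f (r i) (r (Suc i)))" by simp
    then show ?thesis unfolding S_def using p q rq[of m]
      by (intro CollectI exI[of _ "n + m"] exI[of _ r]) (simp add: add.commute r_def)
  qed
  have d_le: "d x y \<le> f x y" for x y
    unfolding d_def using cInf_lower[OF f_S bdd] .
  have f_le: "f x y \<le> 2 * d x y" for x y
  proof -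
    have "f x y / 2 \<le> d x y"
      unfolding d_def using f_S lower by (intro cInf_greatest) force+
    then show ?thesis by simp
  qed
  have "Metric_space UNIV d"
  proof
    fix x y z
    show "0 \<le> d x y" using f_le[of x y] nonneg[of x y] by linarith
    have "S x y = S y x" using S_sym by blast
    then show "d x y = d y x" by (simp add: d_def)
    show "d x y = 0 \<longleftrightarrow> x = y"
      using f_le[of x y] d_le[of x y] nonneg[of x y] zero[of x y] by auto
    have "d x z - s \<le> d y z" if s: "s \<in> S x y" for s
      unfolding d_def[of y z]
    proof (rule cInf_greatest)
      show "S y z \<noteq> {}" using f_S by blast
      fix t assume "t \<in> S y z"
      then have "d x z \<le> s + t" unfolding d_def using s S_trans bdd by (intro cInf_lower) auto
      then show "d x z - s \<le> t" by simp
    qed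
    then have "d x z - d y z \<le> d x y"
      unfolding d_def[of x y] using f_S by (intro cInf_greatest) force+
    then show "d x z \<le> d x y + d y z" by simp
  qed
  then show ?thesis using that d_le f_le by blast
qed

text \<open>
  The metrization of a uniformity with a countable base: \<open>(1/2) ^ n\<close>, for the first \<open>n\<close> whose entourage
  separates two points, satisfies the relaxed triangle inequality, so it is comparable to a metric.
\<close>

lemma metrizable_of_entourages:
  fixes E :: "nat \<Rightarrow> 'a::t1_space \<Rightarrow> 'a \<Rightarrow> bool"
  assumes refl: "\<And>n x. E n x x" and sym: "\<And>n x y. E n x y \<Longrightarrow> E n y x"
    and comp: "\<And>n a b c d. E (Suc n) a b \<Longrightarrow> E (Suc n) b c \<Longrightarrow> E (Suc n) c d \<Longrightarrow> E n a d"
    and nbhd: "\<And>n x. is_nbhd x {y. E n x y}"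
    and base: "\<And>x W. is_nbhd x W \<Longrightarrow> \<exists>n. {y. E n x y} \<subseteq> W"
  shows "metrizable_space (euclidean :: 'a topology)"
proof -
  have dec: "E m x y" if "E n x y" "m \<le> n" for m n x y
    using that(2,1) by (induction rule: inc_induct) (use comp refl in blast)+
  define f where "f x y = (if \<forall>n. E n x y then 0 else (1/2::real) ^ (LEAST n. \<not> E n x y))" for x y
  have f_lt: "E n x y" if "f x y < (1/2) ^ n" for n x y
  proof (rule ccontr)
    assume n: "\<not> E n x y"
    then have "(LEAST n. \<not> E n x y) \<le> n" by (rule Least_le)
    then have "(1/2::real) ^ n \<le> (1/2) ^ (LEAST n. \<not> E n x y)" by (intro power_decreasing) auto
    moreover have "f x y = (1/2) ^ (LEAST n. \<not> E n x y)" using n by (auto simp: f_def)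
    ultimately show False using that by linarith
  qed
  have f_le: "f x y < (1/2) ^ n" if "E n x y" for n x y
  proof (cases "\<forall>n. E n x y")
    case True
    then show ?thesis by (simp add: f_def)
  next
    case False
    then have "\<not> E (LEAST n. \<not> E n x y) x y" by (metis (mono_tags, lifting) LeastI_ex)
    then have "n < (LEAST n. \<not> E n x y)" using dec that by (meson not_le)
    then show ?thesis using False by (auto simp: f_def intro: power_strict_decreasing)
  qed
  have nonneg: "0 \<le> f x y" for x y by (simp add: f_def)
  have zero: "f x y = 0 \<longleftrightarrow> x = y" for x y
  proof
    assume 0: "f x y = 0"
    show "x = y"
    proof (rule ccontr)
      assume "x \<noteq> y"
      then have "is_nbhd x (- {y})" by (intro open_is_nbhd) auto
      then obtain n where "{z. E n x z} \<subseteq> - {y}" using base by blast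
      moreover have "E n x y" by (rule f_lt) (simp add: 0)
      ultimately show False by blast
    qed
  qed (simp add: f_def refl)
  have f_sym: "f x y = f y x" for x y
  proof -
    have "E n x y \<longleftrightarrow> E n y x" for n using sym by blast
    then show ?thesis unfolding f_def by presburger
  qed
  have relaxed: "f a d \<le> 2 * e" if "f a b \<le> e" "f b c \<le> e" "f c d \<le> e" for a b c d e
  proof (rule ccontr)
    assume *: "\<not> f a d \<le> 2 * e"
    have "0 \<le> e" using nonneg[of a b] that by linarith
    with * have "f a d \<noteq> 0" by linarith
    then have neq: "\<not> (\<forall>n. E n a d)" unfolding f_def by metis
    define n where "n = (LEAST n. \<not> E n a d)"
    have "f a d = (1/2) ^ n" using neq by (simp add: f_def n_def)
    with * have "e < (1/2) ^ Suc n" by simp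
    then have "E (Suc n) a b" "E (Suc n) b c" "E (Suc n) c d" using that by (auto intro!: f_lt)
    then have "E n a d" by (rule comp)
    moreover have "\<not> E n a d" unfolding n_def using neq by (metis (mono_tags, lifting) LeastI_ex)
    ultimately show False by blast
  qed
  obtain d where "Metric_space UNIV d" and df: "\<And>x y. d x y \<le> f x y" and fd: "\<And>x y. f x y \<le> 2 * d x y"
    by (rule metric_between_relaxed_metric[of f, OF nonneg zero f_sym]) (erule (2) relaxed, rule that)
  then interpret Metric_space UNIV d by simp
  have ball_E: "mball x ((1/2) ^ Suc n) \<subseteq> {y. E n x y}" for x n
  proof (intro subsetI CollectI f_lt)
    fix y assume "y \<in> mball x ((1/2) ^ Suc n)"
    then have "d x y < (1/2) ^ Suc n" by (simp add: in_mball)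
    then show "f x y < (1/2) ^ n" using fd[of x y] by simp
  qed
  have E_ball: "{y. E n x y} \<subseteq> mball x ((1/2) ^ n)" for x n
    using le_less_trans[OF df f_le] by (auto simp: in_mball)
  have "open U \<longleftrightarrow> openin mtopology U" for U
  proof
    assume "open U"
    have ball: "\<exists>r>0. mball x r \<subseteq> U" if x: "x \<in> U" for x
    proof -
      obtain n where "{y. E n x y} \<subseteq> U" using base[OF open_is_nbhd[OF \<open>open U\<close> x]] by blast
      with ball_E[of x n] have "mball x ((1/2) ^ Suc n) \<subseteq> U" by (rule order_trans)
      moreover have "(0::real) < (1/2) ^ Suc n" by simp
      ultimately show ?thesis by blast
    qed
    show "openin mtopology U"
      unfolding openin_mtopology by (intro conjI allI impI subset_UNIV ball)
  next
    assume U: "openin mtopology U"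
    show "open U"
    proof (rule Topological_Spaces.openI)
      fix x assume "x \<in> U"
      then obtain r where r: "r > 0" "mball x r \<subseteq> U" using U by (auto simp: openin_mtopology)
      obtain n where "(1/2::real) ^ n < r" using real_arch_pow_inv[OF r(1), of "1/2"] by auto
      then have "mball x ((1/2) ^ n) \<subseteq> mball x r" by (intro mball_subset_concentric) simp
      with E_ball[of n x] r(2) have "{y. E n x y} \<subseteq> U" by blast
      then show "\<exists>T. open T \<and> x \<in> T \<and> T \<subseteq> U"
        using is_nbhd_mono[OF nbhd] unfolding is_nbhd_def by blast
    qed
  qed
  then have "(euclidean :: 'a topology) = mtopology"
    by (simp add: topology_eq)
  then show ?thesis
    unfolding metrizable_space_def using Metric_space_axioms by blast
qed

text \<open>
  Frink's condition is not symmetric and its \<open>m\<close> depends on \<open>x\<close>. Iterating \<open>n \<mapsto> m\<close>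
  separately at each point \<open>x\<close>, starting at 0, gives sets \<open>V k x\<close> for which it becomes symmetric and uniform: of
  two intersecting sets \<open>V (Suc k) x\<close> and \<open>V (Suc k) y\<close>, the one with the larger index in the
  original base is absorbed by the stage \<open>k\<close> set of the other point, which hence contains both.
\<close>

lemma Frink_metrization:
  fixes U :: "nat \<Rightarrow> 'a::t1_space \<Rightarrow> 'a set"
  assumes base: "\<And>x. decreasing_nbhd_base_at x (\<lambda>n. U n x)"
    and Frink: "\<And>x n. \<exists>m. \<forall>y. U m x \<inter> U m y \<noteq> {} \<longrightarrow> U m y \<subseteq> U n x"
  shows "metrizable_space (euclidean :: 'a topology)"
proof -
  have nb: "is_nbhd x (U n x)" for n x
    using base unfolding decreasing_nbhd_base_at_def by blast
  have anti: "U n x \<subseteq> U m x" if "m \<le> n" for m n x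
    using base[of x] that unfolding decreasing_nbhd_base_at_def antimono_def by blast
  have "\<exists>m>n. \<forall>y. U m x \<inter> U m y \<noteq> {} \<longrightarrow> U m y \<subseteq> U n x" for x n
  proof -
    obtain m where m: "\<forall>y. U m x \<inter> U m y \<noteq> {} \<longrightarrow> U m y \<subseteq> U n x" using Frink by blast
    have le: "U (max m (Suc n)) y \<subseteq> U m y" for y by (rule anti) simp
    show ?thesis
    proof (intro exI conjI allI impI)
      show "n < max m (Suc n)" by simp
      fix y assume "U (max m (Suc n)) x \<inter> U (max m (Suc n)) y \<noteq> {}"
      then have "U m x \<inter> U m y \<noteq> {}" using le by blast
      then show "U (max m (Suc n)) y \<subseteq> U n x" using m le by blast
    qed
  qed
  then have "\<forall>x n. \<exists>m. n < m \<and> (\<forall>y. U m x \<inter> U m y \<noteq> {} \<longrightarrow> U m y \<subseteq> U n x)" by blast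
  then obtain \<mu> where
    "\<forall>x n. n < \<mu> x n \<and> (\<forall>y. U (\<mu> x n) x \<inter> U (\<mu> x n) y \<noteq> {} \<longrightarrow> U (\<mu> x n) y \<subseteq> U n x)"
    unfolding choice_iff by (elim exE)
  then have \<mu>_gt: "n < \<mu> x n"
    and \<mu>: "U (\<mu> x n) x \<inter> U (\<mu> x n) y \<noteq> {} \<Longrightarrow> U (\<mu> x n) y \<subseteq> U n x" for x n y
    by blast+
  define V where "V k x = U ((\<mu> x ^^ k) 0) x" for k x
  have index_ge: "k \<le> (\<mu> x ^^ k) 0" for k x
    by (induction k) (use \<mu>_gt in \<open>auto intro: le_less_trans simp: Suc_le_eq\<close>)
  have step1: "V (Suc k) y \<subseteq> V k x"
    if "V (Suc k) x \<inter> V (Suc k) y \<noteq> {}" "(\<mu> x ^^ Suc k) 0 \<le> (\<mu> y ^^ Suc k) 0" for k x y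
  proof -
    have "V (Suc k) y \<subseteq> U ((\<mu> x ^^ Suc k) 0) y"
      unfolding V_def using that(2) by (rule anti)
    with that(1) \<mu>[of x "(\<mu> x ^^ k) 0" y] show ?thesis by (auto simp: V_def)
  qed
  have V_dec: "V (Suc k) x \<subseteq> V k x" for k x
    unfolding V_def by (rule anti) (simp add: \<mu>_gt less_imp_le)
  have step: "\<exists>z. V (Suc k) x \<union> V (Suc k) y \<subseteq> V k z"
    if "V (Suc k) x \<inter> V (Suc k) y \<noteq> {}" for k x y
  proof (cases "(\<mu> x ^^ Suc k) 0 \<le> (\<mu> y ^^ Suc k) 0")
    case True
    then show ?thesis using step1[of k x y] that V_dec[of k x] by blast
  next
    case False
    then have "(\<mu> y ^^ Suc k) 0 \<le> (\<mu> x ^^ Suc k) 0" by (meson nat_le_linear)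
    then show ?thesis using step1[of k y x] that V_dec[of k y] by blast
  qed
  define E where "E k x y \<longleftrightarrow> (\<exists>z. x \<in> V k z \<and> y \<in> V k z)" for k x y
  have comp2: "E k a c" if "E (Suc k) a b" "E (Suc k) b c" for k a b c
  proof -
    obtain u v where "a \<in> V (Suc k) u" "b \<in> V (Suc k) u" "b \<in> V (Suc k) v" "c \<in> V (Suc k) v"
      using \<open>E (Suc k) a b\<close> \<open>E (Suc k) b c\<close> unfolding E_def by blast
    then show ?thesis using step[of k u v] unfolding E_def by blast
  qed
  have V_nb: "is_nbhd x (V k x)" for k x by (simp add: V_def nb)
  have E_refl: "E k x x" for k x
    unfolding E_def using mem_is_nbhd[OF V_nb] by blast
  show ?thesis
  \<comment> \<open>Composing two relations costs one index, composing three costs at most two.\<close>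
  proof (rule metrizable_of_entourages[of "\<lambda>k. E (2 * k)"])
    show "E (2 * n) a d" if "E (2 * Suc n) a b" "E (2 * Suc n) b c" "E (2 * Suc n) c d" for n a b c d
    proof -
      have E: "E (Suc (Suc (2 * n))) a b" "E (Suc (Suc (2 * n))) b c" "E (Suc (Suc (2 * n))) c d"
        using that by simp_all
      have "E (Suc (2 * n)) a c" using E(1,2) by (rule comp2)
      moreover have "E (Suc (2 * n)) c d" using E(3) E_refl by (rule comp2)
      ultimately show ?thesis by (rule comp2)
    qed
    show "is_nbhd x {y. E (2 * n) x y}" for n x
      by (rule is_nbhd_mono[OF V_nb[of x "2 * n"]]) (auto simp: E_def intro: mem_is_nbhd[OF V_nb])
    show "\<exists>n. {y. E (2 * n) x y} \<subseteq> W" if W: "is_nbhd x W" for x W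
    proof -
      obtain n where n: "U n x \<subseteq> W" using base W unfolding decreasing_nbhd_base_at_def by blast
      obtain m where m: "\<And>y. U m x \<inter> U m y \<noteq> {} \<Longrightarrow> U m y \<subseteq> U n x" using Frink by blast
      have "V (2 * m) z \<subseteq> U n x" if "x \<in> V (2 * m) z" for z
      proof -
        have "V (2 * m) z \<subseteq> U m z"
          unfolding V_def using index_ge[of "2 * m" z] by (intro anti) simp
        moreover from this have "U m z \<subseteq> U n x"
          using that mem_is_nbhd[OF nb] by (intro m) blast
        ultimately show ?thesis by blast
      qed
      with n have "{y. E (2 * m) x y} \<subseteq> W" unfolding E_def by blast
      then show ?thesis ..
    qed
  qed (auto simp: E_refl, auto simp: E_def)
qed

section \<open>Gyrogroups\<close>

context gyrogroup
begin

text \<open>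
  Gyroassociativity turns \<open>\<ominus> x \<oplus> (x \<oplus> a)\<close> into the image of \<open>a\<close> under a gyration, which is
  injective.
\<close>

lemma left_cancel: "x \<oplus> a = x \<oplus> b \<longleftrightarrow> a = b"
proof
  assume "x \<oplus> a = x \<oplus> b"
  then have "gyr (\<ominus> x) x a = gyr (\<ominus> x) x b"
    using gyr_assoc[of "\<ominus> x" x a] gyr_assoc[of "\<ominus> x" x b] by (simp add: minus_left zero_left)
  then show "a = b" using gyr_bij by (meson bij_is_inj injD)
qed simp

text \<open>
  The gyration that gyroassociativity produces here is trivial: by the loop property
  \<open>gyr (\<ominus> x) x = gyr (\<ominus> x \<oplus> x) x = gyr \<zero> x\<close>.
\<close>

lemma minus_add_cancel_left: "\<ominus> x \<oplus> (x \<oplus> z) = z"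
proof -
  have "x \<oplus> z = x \<oplus> gyr \<zero> x z" using gyr_assoc[of \<zero> x z] by (simp add: zero_left)
  then have "gyr \<zero> x z = z" by (simp add: left_cancel)
  moreover have "gyr \<zero> x = gyr (\<ominus> x) x" using gyr_loop[of "\<ominus> x" x] by (simp add: minus_left)
  ultimately show ?thesis using gyr_assoc[of "\<ominus> x" x z] by (simp add: minus_left zero_left)
qed

lemma minus_minus: "\<ominus> (\<ominus> x) = x"
  using minus_unique[of x "\<ominus> x"] by (simp add: minus_left minus_right)

lemma add_minus_cancel_left: "x \<oplus> (\<ominus> x \<oplus> z) = z"
  using minus_add_cancel_left[of "\<ominus> x" z] by (simp add: minus_minus)

text \<open>
  Gyrations are thus jointly continuous in all three arguments once the operations are.
\<close>

lemma gyr_eq: "gyr x y z = \<ominus> (x \<oplus> y) \<oplus> (x \<oplus> (y \<oplus> z))"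
  using gyr_assoc[of x y z] by (simp add: minus_add_cancel_left)

text \<open>
  The inverse of right translation by \<open>u\<close>, which in a gyrogroup is in general not right translation by \<open>\<ominus> u\<close>.
\<close>

definition right_diff :: "'a \<Rightarrow> 'a \<Rightarrow> 'a" where
  "right_diff y u = y \<oplus> gyr y u (\<ominus> u)"

text \<open>
  Adding \<open>gyr x u (\<ominus> u)\<close> to \<open>x \<oplus> u\<close> on the right gives back \<open>x\<close>. The loop property rewrites \<open>gyr x u\<close> as
  \<open>gyr (x \<oplus> u) u\<close>, so that the correction depends on \<open>x\<close> only through \<open>x \<oplus> u\<close>.
\<close>

lemma right_diff_add: "right_diff (x \<oplus> u) u = x"
proof -
  have "x = (x \<oplus> u) \<oplus> gyr x u (\<ominus> u)"
    using gyr_assoc[of x u "\<ominus> u"] by (simp add: minus_right zero_right)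
  then show ?thesis by (simp add: right_diff_def gyr_loop)
qed

lemma right_diff_zero: "right_diff x \<zero> = x"
  using right_diff_add[of x \<zero>] by (simp add: zero_right)

end

context topological_gyrogroup
begin

lemma continuous_on_add:
  assumes "continuous_on S f" "continuous_on S g"
  shows "continuous_on S (\<lambda>x. f x \<oplus> g x)"
  using continuous_on_compose2[OF continuous_add continuous_on_Pair[OF assms]] by simp

lemma continuous_on_minus:
  assumes "continuous_on S f"
  shows "continuous_on S (\<lambda>x. \<ominus> f x)"
  using continuous_on_compose2[OF continuous_minus assms] by simp

lemma continuous_on_right_diff:
  assumes "continuous_on S f" "continuous_on S g"
  shows "continuous_on S (\<lambda>x. right_diff (f x) (g x))"
  unfolding right_diff_def gyr_eq by (intro continuous_on_add continuous_on_minus assms)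

lemma open_translate: "open ((\<oplus>) x ` W)" if "open W"
proof -
  have "(\<oplus>) x ` W = (\<lambda>y. \<ominus> x \<oplus> y) -` W"
  proof (intro subset_antisym subsetI)
    fix y assume "y \<in> (\<lambda>y. \<ominus> x \<oplus> y) -` W"
    then show "y \<in> (\<oplus>) x ` W"
      using add_minus_cancel_left[of x y] by (metis imageI vimageD)
  qed (auto simp: minus_add_cancel_left)
  moreover have "open ((\<lambda>y. \<ominus> x \<oplus> y) -` W)"
    by (intro open_vimage that continuous_on_add continuous_on_const continuous_on_id)
  ultimately show ?thesis by simp
qed

lemma decreasing_nbhd_base_translate:
  assumes B: "decreasing_nbhd_base_at \<zero> B"
  shows "decreasing_nbhd_base_at x (\<lambda>n. (\<oplus>) x ` B n)"
proof -
  have tr: "is_nbhd (x \<oplus> y) ((\<oplus>) x ` W)" if "is_nbhd y W" for x y W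
    using that open_translate[of _ x] unfolding is_nbhd_def by (meson image_mono imageI)
  have "is_nbhd x ((\<oplus>) x ` B n)" for n
    using tr[of \<zero> "B n" x] B by (simp add: zero_right decreasing_nbhd_base_at_def)
  moreover have "antimono (\<lambda>n. (\<oplus>) x ` B n)"
    using B unfolding decreasing_nbhd_base_at_def antimono_def by (meson image_mono)
  moreover have "\<exists>n. (\<oplus>) x ` B n \<subseteq> W" if "is_nbhd x W" for W
  proof -
    have "is_nbhd \<zero> ((\<oplus>) (\<ominus> x) ` W)" using tr[OF that, of "\<ominus> x"] by (simp add: minus_left)
    then obtain n where "B n \<subseteq> (\<oplus>) (\<ominus> x) ` W"
      using B unfolding decreasing_nbhd_base_at_def by blast
    then have "(\<oplus>) x ` B n \<subseteq> W" by (force simp: add_minus_cancel_left)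
    then show ?thesis ..
  qed
  ultimately show ?thesis unfolding decreasing_nbhd_base_at_def by blast
qed

text \<open>
  Frink's condition for the translated base: if \<open>x \<oplus> a = y \<oplus> b\<close>, then
  \<open>y = right_diff (x \<oplus> a) b\<close>, so \<open>\<ominus> x \<oplus> (y \<oplus> c)\<close> is a continuous function \<open>h\<close> of \<open>(a, b, c)\<close>
  that vanishes at \<open>(\<zero>, \<zero>, \<zero>)\<close>.
\<close>

lemma metrizable_if_countable_base_at_zero:
  assumes B: "decreasing_nbhd_base_at \<zero> B"
  shows "metrizable_space (euclidean :: 'a topology)"
proof (rule Frink_metrization[OF decreasing_nbhd_base_translate[OF B]])
  fix x n
  define h where "h = (\<lambda>(a, b, c). \<ominus> x \<oplus> (right_diff (x \<oplus> a) b \<oplus> c))"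
  obtain W where W: "open W" "\<zero> \<in> W" "W \<subseteq> B n"
    using B unfolding decreasing_nbhd_base_at_def is_nbhd_def by metis
  have "continuous_on UNIV h"
    unfolding h_def case_prod_beta
    by (intro continuous_on_add continuous_on_right_diff continuous_on_const
        continuous_on_fst continuous_on_snd continuous_on_id)
  then have "open (h -` W)" using W(1) by (rule open_vimage[rotated])
  moreover have "(\<zero>, \<zero>, \<zero>) \<in> h -` W"
    using W by (simp add: h_def zero_right right_diff_zero minus_left)
  ultimately obtain P Q where PQ: "open P" "open Q" "(\<zero>, \<zero>, \<zero>) \<in> P \<times> Q" "P \<times> Q \<subseteq> h -` W"
    by (rule open_prod_elim)
  have "(\<zero>, \<zero>) \<in> Q" using PQ(3) by simp
  with PQ(2) obtain R S where RS: "open R" "open S" "(\<zero>, \<zero>) \<in> R \<times> S" "R \<times> S \<subseteq> Q"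
    by (rule open_prod_elim)
  have "is_nbhd \<zero> (P \<inter> R \<inter> S)" using PQ RS by (intro open_is_nbhd) auto
  then obtain m where m: "B m \<subseteq> P \<inter> R \<inter> S"
    using B unfolding decreasing_nbhd_base_at_def by blast
  have "(\<oplus>) y ` B m \<subseteq> (\<oplus>) x ` B n" if ne: "(\<oplus>) x ` B m \<inter> (\<oplus>) y ` B m \<noteq> {}" for y
  proof
    obtain a b where ab: "a \<in> B m" "b \<in> B m" "x \<oplus> a = y \<oplus> b" using ne by blast
    then have y: "y = right_diff (x \<oplus> a) b" by (simp add: right_diff_add)
    fix z assume "z \<in> (\<oplus>) y ` B m"
    then obtain c where c: "c \<in> B m" "z = y \<oplus> c" by blast
    have "(a, b, c) \<in> h -` W" using PQ RS m ab c by blast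
    then have "\<ominus> x \<oplus> z \<in> B n" using W(3) y c by (auto simp: h_def)
    then show "z \<in> (\<oplus>) x ` B n" by (metis add_minus_cancel_left imageI)
  qed
  then show "\<exists>m. \<forall>y. (\<oplus>) x ` B m \<inter> (\<oplus>) y ` B m \<noteq> {} \<longrightarrow> (\<oplus>) y ` B m \<subseteq> (\<oplus>) x ` B n"
    by blast
qed

text \<open>
  Passing to closures is harmless because the space is regular at \<open>\<zero>\<close>: a point \<open>x\<close> in the
  closure of \<open>V\<close> has some \<open>x \<oplus> u\<close> in \<open>V\<close> with \<open>u \<in> V\<close>, so it is a right difference of two elements of \<open>V\<close>.
\<close>

lemma nbhd_zero_contains_closed_square:
  assumes "is_nbhd \<zero> W"
  obtains V where "open V" "\<zero> \<in> V" "\<And>a b. a \<in> closure V \<Longrightarrow> b \<in> closure V \<Longrightarrow> \<ominus> a \<oplus> b \<in> W"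
proof -
  have square: "\<exists>V. open V \<and> \<zero> \<in> V \<and> (\<forall>a\<in>V. \<forall>b\<in>V. g (a, b) \<in> W)"
    if "is_nbhd \<zero> W" "continuous_on UNIV g" "g (\<zero>, \<zero>) = \<zero>" for g :: "'a \<times> 'a \<Rightarrow> 'a" and W
  proof -
    obtain W' where W': "open W'" "\<zero> \<in> W'" "W' \<subseteq> W" using \<open>is_nbhd \<zero> W\<close> unfolding is_nbhd_def by blast
    have "open (g -` W')" using W'(1) that(2) by (rule open_vimage)
    moreover have "(\<zero>, \<zero>) \<in> g -` W'" using W' that by simp
    ultimately obtain P Q where "open P" "open Q" "(\<zero>, \<zero>) \<in> P \<times> Q" "P \<times> Q \<subseteq> g -` W'"
      by (rule open_prod_elim)
    then show ?thesis using W'(3) by (intro exI[of _ "P \<inter> Q"]) auto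
  qed
  have "continuous_on UNIV (\<lambda>p :: 'a \<times> 'a. \<ominus> fst p \<oplus> snd p)"
    by (intro continuous_on_add continuous_on_minus continuous_on_fst continuous_on_snd continuous_on_id)
  from square[OF assms this] obtain V1 where V1: "open V1" "\<zero> \<in> V1"
    and V1_W: "\<And>a b. a \<in> V1 \<Longrightarrow> b \<in> V1 \<Longrightarrow> \<ominus> a \<oplus> b \<in> W"
    by (auto simp: minus_left)
  have "continuous_on UNIV (\<lambda>p :: 'a \<times> 'a. right_diff (fst p) (snd p))"
    by (intro continuous_on_right_diff continuous_on_fst continuous_on_snd continuous_on_id)
  from square[OF open_is_nbhd[OF V1] this] obtain V where V: "open V" "\<zero> \<in> V"
    and V_V1: "\<And>a b. a \<in> V \<Longrightarrow> b \<in> V \<Longrightarrow> right_diff a b \<in> V1"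
    by (auto simp: right_diff_zero)
  have "closure V \<subseteq> V1"
  proof
    fix x assume x: "x \<in> closure V"
    have "open ((\<oplus>) x ` V)" "x \<in> (\<oplus>) x ` V"
      using V open_translate zero_right[of x] by (auto intro: rev_image_eqI)
    with x have "(\<oplus>) x ` V \<inter> V \<noteq> {}"
      by (metis closure_iff_nhds_not_empty Int_commute subset_refl)
    then obtain u where "u \<in> V" "x \<oplus> u \<in> V" by blast
    then show "x \<in> V1" using V_V1[of "x \<oplus> u" u] by (simp add: right_diff_add)
  qed
  then show ?thesis using that V V1_W by blast
qed

end

section \<open>Baire spaces\<close>

text \<open>
  Otherwise the complements of the closures would be countably many dense open sets whose intersection
  misses \<open>V\<close>.
\<close>

lemma Baire_countable_cover_somewhere_dense:
  fixes V :: "'a::topological_space set"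
  assumes "baire_space TYPE('a)" "countable \<N>" "open V" "V \<noteq> {}" "V \<subseteq> \<Union>\<N>"
  shows "\<exists>N\<in>\<N>. interior (closure N) \<noteq> {}"
proof (rule ccontr)
  assume "\<not> ?thesis"
  then have empty: "interior (closure N) = {}" if "N \<in> \<N>" for N using that by blast
  define \<G> where "\<G> = (\<lambda>N. - closure N) ` \<N>"
  have "open G \<and> closure G = UNIV" if "G \<in> \<G>" for G
    using that empty by (auto simp: \<G>_def closure_complement)
  moreover have "countable \<G>" using assms(2) by (simp add: \<G>_def)
  ultimately have "closure (\<Inter>\<G>) = UNIV" using assms(1) unfolding baire_space_def by blast
  then have "V \<inter> \<Inter>\<G> \<noteq> {}"
    using assms(3,4) open_Int_closure_eq_empty by (metis Int_UNIV_right)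
  then obtain x where x: "x \<in> V" "x \<in> \<Inter>\<G>" by blast
  with assms(5) obtain N where "N \<in> \<N>" "x \<in> N" by blast
  then show False using x closure_subset[of N] unfolding \<G>_def by blast
qed

text \<open>
  The sets \<open>D N\<close>, for the members \<open>N\<close> of the network whose closure has nonempty interior, form a countable
  neighborhood base at \<open>\<zero>\<close>.
\<close>

lemma (in topological_gyrogroup) metrizable_if_Baire_cn_network:
  assumes Baire: "baire_space TYPE('a)" and "countable \<N>" and cn: "cn_network_at \<zero> \<N>"
  shows "metrizable_space (euclidean :: 'a topology)"
proof -
  define D where "D N = (\<lambda>(a, b). \<ominus> a \<oplus> b) ` (closure N \<times> closure N)" for N
  have D_nbhd: "is_nbhd \<zero> (D N)" if int: "interior (closure N) \<noteq> {}" for N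
  proof -
    obtain x where x: "x \<in> interior (closure N)" using int by blast
    have "open ((\<oplus>) (\<ominus> x) ` interior (closure N))" by (simp add: open_translate)
    moreover have "\<zero> \<in> (\<oplus>) (\<ominus> x) ` interior (closure N)"
      using x minus_left[of x] by (metis imageI)
    moreover have "(\<oplus>) (\<ominus> x) ` interior (closure N) \<subseteq> D N"
      unfolding D_def using x interior_subset[of "closure N"] by force
    ultimately show ?thesis unfolding is_nbhd_def by blast
  qed
  define \<B> where "\<B> = D ` {N \<in> \<N>. interior (closure N) \<noteq> {}}"
  have "countable \<B>" unfolding \<B>_def using assms(2) by auto
  moreover have "is_nbhd \<zero> B" if "B \<in> \<B>" for B using that D_nbhd unfolding \<B>_def by blast
  moreover have "\<exists>B\<in>\<B>. B \<subseteq> W" if W: "is_nbhd \<zero> W" for W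
  proof -
    obtain V where V: "open V" "\<zero> \<in> V"
      and VW: "\<And>a b. a \<in> closure V \<Longrightarrow> b \<in> closure V \<Longrightarrow> \<ominus> a \<oplus> b \<in> W"
      using nbhd_zero_contains_closed_square[OF W] by blast
    define \<M> where "\<M> = {N \<in> \<N>. \<zero> \<in> N \<and> N \<subseteq> V}"
    have "is_nbhd \<zero> (\<Union>\<M>)"
      using cn open_is_nbhd[OF V] unfolding cn_network_at_def \<M>_def by blast
    then obtain O' where O': "open O'" "\<zero> \<in> O'" "O' \<subseteq> \<Union>\<M>" unfolding is_nbhd_def by blast
    have "countable \<M>" unfolding \<M>_def using assms(2) by auto
    then obtain N where N: "N \<in> \<M>" "interior (closure N) \<noteq> {}"
      using Baire_countable_cover_somewhere_dense[OF Baire _ O'(1) _ O'(3)] O'(2) by blast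
    then have "closure N \<subseteq> closure V" by (auto simp: \<M>_def closure_mono)
    then have "D N \<subseteq> W" unfolding D_def using VW by auto
    moreover have "D N \<in> \<B>" using N unfolding \<B>_def \<M>_def by blast
    ultimately show ?thesis by blast
  qed
  ultimately obtain B where "decreasing_nbhd_base_at \<zero> B"
    using countable_nbhd_base_imp_decreasing by blast
  then show ?thesis by (rule metrizable_if_countable_base_at_zero)
qed

section \<open>Local networks\<close>

text \<open>
  If the union \<open>Y\<close> of the members inside \<open>W\<close> were not a neighborhood of \<open>x\<close>, then \<open>x\<close> would be in the
  closure of \<open>- Y\<close>, and some \<open>D n \<subseteq> W\<close> would meet \<open>- Y\<close>, although \<open>D n \<subseteq> Y\<close>. The point \<open>x\<close> is added to each
  set because only members containing \<open>x\<close> count in a \<open>cn\<close>-network.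
\<close>

lemma strong_Pytkeev_imp_cn_network:
  assumes "strong_Pytkeev_at x"
  obtains \<N> where "countable \<N>" "cn_network_at x \<N>"
proof -
  obtain D :: "nat \<Rightarrow> 'a set" where D:
    "\<And>U A. is_nbhd x U \<Longrightarrow> x \<in> closure A - A \<Longrightarrow> \<exists>n. D n \<subseteq> U \<and> infinite (D n \<inter> A)"
    using assms unfolding strong_Pytkeev_at_def by blast
  \<comment> \<open>The member \<open>{x}\<close> ensures \<open>x \<in> Y\<close> even if no \<open>D n\<close> lies inside \<open>W\<close>.\<close>
  define \<N> where "\<N> = insert {x} (range (\<lambda>n. insert x (D n)))"
  have "cn_network_at x \<N>"
    unfolding cn_network_at_def
  proof (intro allI impI)
    fix W assume W: "is_nbhd x W"
    have xW: "x \<in> W" using W by (rule mem_is_nbhd)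
    define Y where "Y = \<Union>{N \<in> \<N>. x \<in> N \<and> N \<subseteq> W}"
    have xY: "x \<in> Y" unfolding Y_def \<N>_def using xW by auto
    have DY: "D n \<subseteq> Y" if "D n \<subseteq> W" for n
    proof -
      have "insert x (D n) \<in> {N \<in> \<N>. x \<in> N \<and> N \<subseteq> W}" using that xW by (auto simp: \<N>_def)
      then show ?thesis unfolding Y_def by blast
    qed
    have "x \<notin> closure (- Y)"
    proof
      assume "x \<in> closure (- Y)"
      then obtain n where "D n \<subseteq> W" "infinite (D n \<inter> - Y)" using D[OF W, of "- Y"] xY by blast
      then show False using DY[of n] by (simp add: Diff_eq[symmetric] Diff_eq_empty_iff[THEN iffD2])
    qed
    then have "x \<in> interior Y" by (simp add: closure_complement)
    then show "is_nbhd x (\<Union>{N \<in> \<N>. x \<in> N \<and> N \<subseteq> W})"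
      unfolding Y_def[symmetric] is_nbhd_def using open_interior interior_subset by blast
  qed
  moreover have "countable \<N>" by (simp add: \<N>_def)
  ultimately show ?thesis using that by blast
qed

text \<open>
  Singletons are compact.
\<close>

lemma ck_network_imp_cn_network: "ck_network_at x \<N> \<Longrightarrow> cn_network_at x \<N>"
  unfolding cn_network_at_def
proof (intro allI impI)
  fix W assume "ck_network_at x \<N>" "is_nbhd x W"
  then obtain U where U: "is_nbhd x U" and K: "\<And>K. compact K \<Longrightarrow> K \<subseteq> U \<Longrightarrow>
      \<exists>\<F>. finite \<F> \<and> \<F> \<subseteq> \<N> \<and> x \<in> \<Inter>\<F> \<and> K \<subseteq> \<Union>\<F> \<and> \<Union>\<F> \<subseteq> W"
    unfolding ck_network_at_def by meson
  have "y \<in> \<Union>{N \<in> \<N>. x \<in> N \<and> N \<subseteq> W}" if "y \<in> U" for y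
    using K[of "{y}"] that by fastforce
  then show "is_nbhd x (\<Union>{N \<in> \<N>. x \<in> N \<and> N \<subseteq> W})"
    using is_nbhd_mono[OF U] by blast
qed

text \<open>
  The intersections in the condition (D) depend only on a finite prefix of \<open>\<alpha>\<close>, so there are only
  countably many of them; the condition says that those inside \<open>U \<alpha>\<close> fill it up.
\<close>

lemma condition_D_imp_cn_network:
  assumes "omega_omega_base_at x U" and D: "condition_D U"
  obtains \<N> where "countable \<N>" "cn_network_at x \<N>"
proof -
  define I where "I = (\<lambda>p. \<Inter>\<beta>\<in>{\<beta>. \<forall>i<length p. \<beta> i = p ! i}. U \<beta>)"
  have I: "(\<Inter>\<beta>\<in>same_prefix k \<alpha>. U \<beta>) = I (map \<alpha> [0..<k])" for k \<alpha>
    by (simp add: I_def same_prefix_def)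
  have nb: "is_nbhd x (U \<alpha>)" for \<alpha>
    using assms(1) by (simp add: omega_omega_base_at_def)
  have base: "\<exists>\<alpha>. U \<alpha> \<subseteq> W" if "is_nbhd x W" for W
    using assms(1) that by (simp add: omega_omega_base_at_def)
  have "cn_network_at x (range I)"
    unfolding cn_network_at_def
  proof (intro allI impI)
    fix W assume "is_nbhd x W"
    then obtain \<alpha> where \<alpha>: "U \<alpha> \<subseteq> W" using base by blast
    have U: "U \<alpha> = (\<Union>k\<in>{1..}. I (map \<alpha> [0..<k]))"
      by (rule D[unfolded condition_D_def, rule_format, unfolded I])
    have x_I: "x \<in> I p" for p using mem_is_nbhd[OF nb] by (simp add: I_def)
    have "U \<alpha> \<subseteq> \<Union>{N \<in> range I. x \<in> N \<and> N \<subseteq> W}"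
    proof
      fix y assume "y \<in> U \<alpha>"
      then obtain k where k: "k \<ge> 1" "y \<in> I (map \<alpha> [0..<k])" unfolding U by auto
      then have "I (map \<alpha> [0..<k]) \<subseteq> U \<alpha>" by (subst U) auto
      then show "y \<in> \<Union>{N \<in> range I. x \<in> N \<and> N \<subseteq> W}" using \<alpha> x_I k by blast
    qed
    then show "is_nbhd x (\<Union>{N \<in> range I. x \<in> N \<and> N \<subseteq> W})" using is_nbhd_mono[OF nb] by blast
  qed
  moreover have "countable (range I)" by simp
  ultimately show ?thesis using that by blast
qed

lemma decreasing_nbhd_base_imp_strong_Pytkeev:
  fixes x :: "'a::t1_space"
  assumes "decreasing_nbhd_base_at x B"
  shows "strong_Pytkeev_at x"
  unfolding strong_Pytkeev_at_def
proof (intro exI[of _ B] allI impI, elim conjE)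
  fix U A assume "is_nbhd x U" and x: "x \<in> closure A - A"
  then obtain n where n: "B n \<subseteq> U" "is_nbhd x (B n)"
    using assms unfolding decreasing_nbhd_base_at_def by blast
  then obtain V where V: "open V" "x \<in> V" "V \<subseteq> B n" unfolding is_nbhd_def by blast
  have "x islimpt A" using x by (auto simp: closure_def)
  then have "infinite (A \<inter> V)" using V by (auto simp: islimpt_eq_acc_point Int_commute)
  moreover have "A \<inter> V \<subseteq> B n \<inter> A" using V by blast
  ultimately show "\<exists>n. B n \<subseteq> U \<and> infinite (B n \<inter> A)" using n infinite_super by blast
qed

lemma decreasing_nbhd_base_imp_ck_network:
  assumes "decreasing_nbhd_base_at x B"
  shows "ck_network_at x (range B)"
  unfolding ck_network_at_def
proof (intro allI impI)
  fix W assume "is_nbhd x W"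
  then obtain n where n: "B n \<subseteq> W" "is_nbhd x (B n)"
    using assms unfolding decreasing_nbhd_base_at_def by blast
  then show "\<exists>U. is_nbhd x U \<and> (\<forall>K. compact K \<and> K \<subseteq> U \<longrightarrow>
      (\<exists>\<F>. finite \<F> \<and> \<F> \<subseteq> range B \<and> x \<in> \<Inter>\<F> \<and> K \<subseteq> \<Union>\<F> \<and> \<Union>\<F> \<subseteq> W))"
    by (intro exI[of _ "B n"] conjI allI impI exI[of _ "{B n}"]) (auto dest: mem_is_nbhd)
qed

lemma decreasing_nbhd_base_imp_omega_omega_base:
  assumes "decreasing_nbhd_base_at x B"
  shows "omega_omega_base_at x (\<lambda>\<alpha>. B (\<alpha> 0))" and "condition_D (\<lambda>\<alpha>. B (\<alpha> 0))"
proof -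
  have "B (\<beta> 0) \<subseteq> B (\<alpha> 0)" if "\<alpha> \<le> \<beta>" for \<alpha> \<beta> :: "nat \<Rightarrow> nat"
    using assms that unfolding decreasing_nbhd_base_at_def antimono_def le_fun_def by blast
  moreover have "\<exists>\<alpha>. B (\<alpha> 0) \<subseteq> W" if "is_nbhd x W" for W
  proof -
    obtain n where "B n \<subseteq> W" using assms \<open>is_nbhd x W\<close> unfolding decreasing_nbhd_base_at_def by blast
    then show ?thesis by (intro exI[of _ "\<lambda>_. n"])
  qed
  ultimately show "omega_omega_base_at x (\<lambda>\<alpha>. B (\<alpha> 0))"
    using assms unfolding omega_omega_base_at_def decreasing_nbhd_base_at_def by blast
  have "(\<Inter>\<beta>\<in>same_prefix k \<alpha>. B (\<beta> 0)) = B (\<alpha> 0)" if "k \<ge> 1" for k \<alpha>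
    using that by (auto simp: same_prefix_def)
  then show "condition_D (\<lambda>\<alpha>. B (\<alpha> 0))" unfolding condition_D_def by auto
qed

theorem theorem3p10:
  fixes gadd :: "'a::t2_space \<Rightarrow> 'a \<Rightarrow> 'a"
    and gzero :: "'a"
    and gminus :: "'a \<Rightarrow> 'a"
    and gyr :: "'a \<Rightarrow> 'a \<Rightarrow> 'a \<Rightarrow> 'a"
  assumes "topological_gyrogroup gadd gzero gminus gyr"
    and "baire_space TYPE('a)"
  shows "(metrizable_space (euclidean :: 'a topology) \<longleftrightarrow> strong_Pytkeev_at gzero) \<and>
         (metrizable_space (euclidean :: 'a topology) \<longleftrightarrow> countable_ck_character TYPE('a)) \<and>
         (metrizable_space (euclidean :: 'a topology) \<longleftrightarrow> countable_cn_character TYPE('a)) \<and>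
         (metrizable_space (euclidean :: 'a topology) \<longleftrightarrow>
            (\<exists>U. omega_omega_base_at gzero U \<and> condition_D U))"
proof -
  interpret topological_gyrogroup gadd gzero gminus gyr by fact
  let ?M = "metrizable_space (euclidean :: 'a topology)"
  have cn: ?M if "countable \<N>" "cn_network_at gzero \<N>" for \<N>
    using metrizable_if_Baire_cn_network[OF assms(2) that] .
  have ck_cn: "countable_cn_character TYPE('a)" if "countable_ck_character TYPE('a)"
    using that ck_network_imp_cn_network
    unfolding countable_cn_character_def countable_ck_character_def by meson
  have M_ck: "countable_ck_character TYPE('a)" if ?M
    unfolding countable_ck_character_def
  proof
    fix x :: 'a
    obtain B where "decreasing_nbhd_base_at x B"
      using metrizable_imp_decreasing_nbhd_base[OF \<open>?M\<close>] .
    then have "ck_network_at x (range B)" by (rule decreasing_nbhd_base_imp_ck_network)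
    then show "\<exists>\<N>. countable \<N> \<and> ck_network_at x \<N>" by (intro exI[of _ "range B"]) simp
  qed
  have cn_M: ?M if "countable_cn_character TYPE('a)"
    using that cn unfolding countable_cn_character_def by blast
  have M_base: "\<exists>B. decreasing_nbhd_base_at gzero B" if ?M
    using metrizable_imp_decreasing_nbhd_base[OF that, of gzero] by blast
  have "?M \<longleftrightarrow> strong_Pytkeev_at gzero"
  proof
    assume ?M
    then obtain B where "decreasing_nbhd_base_at gzero B" using M_base by blast
    then show "strong_Pytkeev_at gzero" by (rule decreasing_nbhd_base_imp_strong_Pytkeev)
  next
    assume "strong_Pytkeev_at gzero"
    then show ?M by (rule strong_Pytkeev_imp_cn_network) (rule cn)
  qed
  moreover have "?M \<longleftrightarrow> (\<exists>U. omega_omega_base_at gzero U \<and> condition_D U)"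
  proof
    assume ?M
    then obtain B where "decreasing_nbhd_base_at gzero B" using M_base by blast
    then show "\<exists>U. omega_omega_base_at gzero U \<and> condition_D U"
      by (blast intro: decreasing_nbhd_base_imp_omega_omega_base)
  next
    assume "\<exists>U. omega_omega_base_at gzero U \<and> condition_D U"
    then obtain U where "omega_omega_base_at gzero U" "condition_D U" by blast
    then show ?M by (rule condition_D_imp_cn_network) (rule cn)
  qed
  ultimately show ?thesis using M_ck ck_cn cn_M by blast
qed

end
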